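(* Suppose $W$ and $V$ are infinite dimensional. Let $(X_n)_{n\in\mathbb N}$ be a sequence of finite dimensional subspaces of $X$ satisfying AS and VG. Then the spaces can be augmented by one vector so as to still satisfy AS and VG but not ODF: there exist vectors $u_n\in X\setminus X_n$ ($n\in\mathbb N$) such that the sequence of spaces $\tilde X_n=X_n\oplus\mathbb R u_n$ satisfies AS and VG but does not satisfy ODF.
   Context: Setting. $O$ is an infinite dimensional separable real Hilbert space with scalar product $\langle\cdot,\cdot\rangle$ and norm $|\cdot|$. $X\subseteq O$ is a dense subspace, itself a Hilbert space with continuous inclusion $X\to O$. $a$ is a continuous symmetric bilinear form on $X$ with $a(u,u)\ge 0$ for all $u\in X$, such that $\langle\cdot,\cdot\rangle+a$ is coercive on $X$; this form is taken as the scalar product of $X$, so $\|u\|^2=|u|^2+a(u,u)$ is the norm of $X$. Define $W=\{u\in X: a(u,u')=0\ \forall u'\in X\}$ and $V=\{u\in X:\langle u,w\rangle=0\ \forall w\in W\}$, so $X=V\oplus W$; $W$ is closed in $O$. $\overline V$ is the closure of $V$ in $O$; it is the $O$-orthogonal complement of $W$. $P$ is the $O$-orthogonal projector in $O$ with range $\overline V$ and kernel $W$. It is assumed that the injection $V\to O$ is compact ($V$ carrying the norm of $X$). Conditions. For a sequence $(Y_n)_{n\in\mathbb N}$ of finite dimensional subspaces of $X$, put $W_n=Y_n\cap W=\{u\in Y_n:a(u,u')=0\ \forall u'\in Y_n\}$ and $V_n=\{u\in Y_n:\langle u,w\rangle=0\ \forall w\in W_n\}$. The sequence $(Y_n)$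 satisfies: AS if for all $u\in X$, $\lim_{n\to\infty}\inf_{u'\in Y_n}\|u-u'\|=0$; VG if $\sup_{v\in V_n,v\ne0}\inf_{v'\in V}\|v-v'\|/\|v\|\to0$ as $n\to\infty$ (supremum over the empty set being $0$); ODF if there is $C>0$ such that $|v|\le C|Pv|$ for all $n$ and all $v\in V_n$. *)

theory Defs
  imports "HOL-Analysis.Analysis"
begin

text \<open>
  Throughout, the ambient Hilbert space O is a type of class real_inner and complete_space, and the
  smaller Hilbert space X is a second such type, included in O by an injective bounded linear map
  j. Thus the norm of the second type is the X-norm, and the O-scalar product of two elements
  u, v of X is \<open>j u \<bullet> j v\<close>. Likewise, infdist on the second type is distance in the X-norm.
\<close>

definition finite_dim :: "'a::real_vector set \<Rightarrow> bool" where
  "finite_dim S \<longleftrightarrow> (\<exists>B. finite B \<and> span B = S)"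

definition W_space :: "('x \<Rightarrow> 'x \<Rightarrow> real) \<Rightarrow> 'x set" where
  "W_space a = {u. \<forall>u'. a u u' = 0}"

definition V_space :: "('x \<Rightarrow> 'o::real_inner) \<Rightarrow> ('x \<Rightarrow> 'x \<Rightarrow> real) \<Rightarrow> 'x set" where
  "V_space j a = {u. \<forall>w\<in>W_space a. j u \<bullet> j w = 0}"

text \<open>The orthogonal projector onto a closed subspace of a Hilbert space.\<close>

definition orth_proj :: "'o::real_inner set \<Rightarrow> 'o \<Rightarrow> 'o" where
  "orth_proj S x = (THE p. p \<in> S \<and> (\<forall>s\<in>S. (x - p) \<bullet> s = 0))"

definition P_proj :: "('x \<Rightarrow> 'o::real_inner) \<Rightarrow> ('x \<Rightarrow> 'x \<Rightarrow> real) \<Rightarrow> 'o \<Rightarrow> 'o" where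
  "P_proj j a = orth_proj (closure (j ` V_space j a))"

definition W_sub :: "('x \<Rightarrow> 'x \<Rightarrow> real) \<Rightarrow> 'x set \<Rightarrow> 'x set" where
  "W_sub a Y = Y \<inter> W_space a"

definition V_sub :: "('x \<Rightarrow> 'o::real_inner) \<Rightarrow> ('x \<Rightarrow> 'x \<Rightarrow> real) \<Rightarrow> 'x set \<Rightarrow> 'x set" where
  "V_sub j a Y = {u \<in> Y. \<forall>w\<in>W_sub a Y. j u \<bullet> j w = 0}"

lemma W_sub_altdef:
  fixes a :: "'x::real_normed_vector \<Rightarrow> 'x \<Rightarrow> real"
  assumes bil: "bounded_bilinear a" and sym: "\<And>u v. a u v = a v u" and pos: "\<And>u. a u u \<ge> 0"
  shows "W_sub a Y = {u \<in> Y. \<forall>u'\<in>Y. a u u' = 0}"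
proof -
  interpret bounded_bilinear a by (fact bil)
  have "a u u' = 0" if z: "a u u = 0" for u u'
  proof (rule ccontr)
    assume ne: "a u u' \<noteq> 0"
    define t where "t = - (a u' u' + 1) / (2 * a u u')"
    have "a (u' + t *\<^sub>R u) (u' + t *\<^sub>R u) = a u' u' + 2 * t * a u u'"
      using z sym[of u' u] by (simp add: add_left add_right scaleR_left scaleR_right)
    also have "\<dots> = -1" using ne by (simp add: t_def field_simps)
    finally show False using pos[of "u' + t *\<^sub>R u"] by simp
  qed
  then show ?thesis by (auto simp: W_sub_def W_space_def)
qed

definition AS :: "(nat \<Rightarrow> 'x::metric_space set) \<Rightarrow> bool" where
  "AS Y \<longleftrightarrow> (\<forall>u. (\<lambda>n. infdist u (Y n)) \<longlonglongrightarrow> 0)"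

text \<open>
  The supremum of an empty set of reals is unspecified, hence the case distinction. The quotients
  are bounded by 1 because 0 lies in V.
\<close>

definition V_gap :: "('x::real_normed_vector \<Rightarrow> 'o::real_inner) \<Rightarrow> ('x \<Rightarrow> 'x \<Rightarrow> real) \<Rightarrow> 'x set \<Rightarrow> real"
  where
  "V_gap j a Y =
     (if V_sub j a Y - {0} = {} then 0
      else SUP v\<in>V_sub j a Y - {0}. infdist v (V_space j a) / norm v)"

definition VG :: "('x::real_normed_vector \<Rightarrow> 'o::real_inner) \<Rightarrow> ('x \<Rightarrow> 'x \<Rightarrow> real) \<Rightarrow> (nat \<Rightarrow> 'x set) \<Rightarrow> bool"
  where
  "VG j a Y \<longleftrightarrow> (\<lambda>n. V_gap j a (Y n)) \<longlonglongrightarrow> 0"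

definition ODF :: "('x \<Rightarrow> 'o::real_inner) \<Rightarrow> ('x \<Rightarrow> 'x \<Rightarrow> real) \<Rightarrow> (nat \<Rightarrow> 'x set) \<Rightarrow> bool"
  where
  "ODF j a Y \<longleftrightarrow>
     (\<exists>C>0. \<forall>n. \<forall>v\<in>V_sub j a (Y n). norm (j v) \<le> C * norm (P_proj j a (j v)))"

end

theory Submission
  imports Defs
begin

text \<open>
  The added vector is a sum of some w in W and v in V, both X-orthogonal to the n-th space, with w of
  norm 1, the O-norm of v at most 1/(n+1) and the X-norm of v equal to n+1; such v exist because the
  inclusion of V in O is compact. Orthogonality makes the new discrete V-space the sum of the old
  one and the line through w + v. The size of v in X keeps the gap small, since w + v is at distance
  at most 1 from V but has norm at least n+1, while its smallness in O defeats ODF, since v is the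
  projection of w + v.
\<close>

section \<open>Orthogonal vectors in infinite dimensional subspaces\<close>

text \<open>Each further orthogonality condition lowers the dimension by at most one: either it
  holds automatically, or a single vector \<open>z\<close> violating it, together with the
  solutions, spans the previous space.\<close>

lemma not_finite_dim_orthogonal:
  fixes Z :: "'x::real_inner set"
  assumes "finite S" and Z: "subspace Z" "\<not> finite_dim Z"
  shows "\<not> finite_dim {z \<in> Z. \<forall>s\<in>S. z \<bullet> s = 0}"
  using assms(1)
proof (induction S)
  case empty
  then show ?case using Z by simp
next
  case (insert s S)
  let ?Y = "{z \<in> Z. \<forall>s\<in>S. z \<bullet> s = 0}"
  let ?Y' = "{z \<in> Z. \<forall>s\<in>insert s S. z \<bullet> s = 0}"
  have sub: "subspace ?Y"
    using Z(1) by (auto simp: subspace_def inner_left_distrib)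
  show ?case
  proof
    assume "finite_dim ?Y'"
    then obtain B where B: "finite B" "span B = ?Y'"
      by (auto simp: finite_dim_def)
    show False
    proof (cases "\<exists>z\<in>?Y. z \<bullet> s \<noteq> 0")
      case False
      then have "?Y' = ?Y" by auto
      then show False using B insert.IH by (auto simp: finite_dim_def)
    next
      case True
      then obtain z where z: "z \<in> ?Y" "z \<bullet> s \<noteq> 0" by auto
      have "B \<subseteq> ?Y" using span_superset[of B] B(2) by auto
      then have "span (insert z B) \<subseteq> ?Y"
        using z(1) sub by (intro span_minimal) auto
      moreover have "y \<in> span (insert z B)" if y: "y \<in> ?Y" for y
      proof -
        let ?k = "(y \<bullet> s) / (z \<bullet> s)"
        have "y - ?k *\<^sub>R z \<in> ?Y"
          using sub y z(1) by (intro subspace_diff subspace_scale) auto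
        moreover have "(y - ?k *\<^sub>R z) \<bullet> s = 0"
          using z(2) by (simp add: inner_diff_left)
        ultimately have "y - ?k *\<^sub>R z \<in> span B"
          using B(2) by auto
        then show ?thesis by (auto simp: span_insert)
      qed
      ultimately have "span (insert z B) = ?Y" by blast
      then show False
        using B(1) insert.IH unfolding finite_dim_def by blast
    qed
  qed
qed

text \<open>Orthogonality to finitely many generators passes to their span, so finitely many
  conditions give a vector orthogonal to a whole finite dimensional space.\<close>

lemma obtain_unit_orthogonal:
  fixes Z :: "'x::real_inner set"
  assumes "finite S" "subspace Z" "\<not> finite_dim Z"
  obtains z where "z \<in> Z" "norm z = 1" "\<And>s. s \<in> span S \<Longrightarrow> z \<bullet> s = 0"
proof -
  let ?Y = "{z \<in> Z. \<forall>s\<in>S. z \<bullet> s = 0}"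
  have "?Y \<noteq> {0}"
  proof
    assume "?Y = {0}"
    then have "span {} = ?Y" by simp
    then show False
      using not_finite_dim_orthogonal[OF assms] unfolding finite_dim_def
      by (metis finite.emptyI)
  qed
  moreover have "0 \<in> ?Y" using assms(2) by (simp add: subspace_0)
  ultimately obtain y where y: "y \<in> ?Y" "y \<noteq> 0" by blast
  show ?thesis
  proof (rule that)
    show "sgn y \<in> Z" using y assms(2) by (simp add: sgn_div_norm subspace_scale)
    show "norm (sgn y) = 1" using y by (simp add: norm_sgn)
    show "sgn y \<bullet> s = 0" if "s \<in> span S" for s
    proof -
      have "orthogonal y s"
        using that y(1) by (intro orthogonal_to_span[of s S]) (auto simp: orthogonal_def)
      then show ?thesis by (simp add: sgn_div_norm orthogonal_def)
    qed
  qed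
qed

lemma obtain_orthonormal_sequence:
  fixes Z :: "'x::real_inner set"
  assumes "finite S" "subspace Z" "\<not> finite_dim Z"
  obtains e :: "nat \<Rightarrow> 'x" where "range e \<subseteq> Z" "\<And>k. norm (e k) = 1"
    "\<And>k s. s \<in> span S \<Longrightarrow> e k \<bullet> s = 0" "\<And>k l. k \<noteq> l \<Longrightarrow> e k \<bullet> e l = 0"
proof -
  have "\<forall>T. \<exists>z. finite T \<longrightarrow> z \<in> Z \<and> norm z = 1 \<and> (\<forall>s\<in>span T. z \<bullet> s = 0)"
    using obtain_unit_orthogonal[OF _ assms(2,3)] by metis
  then obtain f where f: "\<And>T. finite T \<Longrightarrow> f T \<in> Z \<and> norm (f T) = 1 \<and> (\<forall>s\<in>span T. f T \<bullet> s = 0)"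
    by metis
  \<comment> \<open>Gram-Schmidt without projections: \<open>T k\<close> consists of
    \<open>S\<close> and the vectors chosen before stage \<open>k\<close>, and the next vector is
    taken orthogonal to all of them.\<close>
  define T where "T = rec_nat S (\<lambda>_ T. insert (f T) T)"
  have T_simps: "T 0 = S" "\<And>k. T (Suc k) = insert (f (T k)) (T k)"
    by (simp_all add: T_def)
  have fin: "finite (T k)" for k
    by (induction k) (auto simp: T_simps assms)
  have mono: "T k \<subseteq> T l" if "k \<le> l" for k l
    using that by (rule lift_Suc_mono_le[of T, rotated]) (auto simp: T_simps)
  have less: "f (T l) \<bullet> f (T k) = 0" if "k < l" for k l
    using f[OF fin[of l]] mono[of "Suc k" l] that by (auto simp: T_simps intro: span_base)
  show ?thesis
  proof (rule that[of "\<lambda>k. f (T k)"])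
    show "f (T k) \<bullet> s = 0" if "s \<in> span S" for k s
      using f[OF fin[of k]] span_mono[OF mono[of 0 k]] that by (auto simp: T_simps)
    show "f (T k) \<bullet> f (T l) = 0" if "k \<noteq> l" for k l
      using less[of k l] less[of l k] that by (cases "k < l") (auto simp: inner_commute)
  qed (use f fin in auto)
qed

text \<open>Compactness gives an orthonormal sequence a subsequence with Cauchy image under
  \<open>j\<close>. Differences of its late terms have tiny images while their own norm stays at the
  square root of 2; rescaling yields the norm \<open>R\<close>.\<close>

lemma obtain_large_with_small_image:
  fixes j :: "'x::real_inner \<Rightarrow> 'o::real_inner"
  assumes j: "bounded_linear j"
    and S: "finite S" and V: "subspace V" "\<not> finite_dim V"
    and compact: "\<And>B. B \<subseteq> V \<Longrightarrow> bounded B \<Longrightarrow> compact (closure (j ` B))"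
    and "0 < R" "0 < \<epsilon>"
  obtains v where "v \<in> V" "norm v = R" "norm (j v) < \<epsilon>" "\<And>s. s \<in> span S \<Longrightarrow> v \<bullet> s = 0"
proof -
  interpret j: bounded_linear j by (fact j)
  obtain e :: "nat \<Rightarrow> 'x" where e: "range e \<subseteq> V" "\<And>k. norm (e k) = 1"
    "\<And>k s. s \<in> span S \<Longrightarrow> e k \<bullet> s = 0" "\<And>k l. k \<noteq> l \<Longrightarrow> e k \<bullet> e l = 0"
    using obtain_orthonormal_sequence[OF S V] by metis
  have "bounded (range e)" unfolding bounded_iff using e(2) by auto
  then have "seq_compact (closure (j ` range e))"
    using compact[OF e(1)] by (simp add: compact_eq_seq_compact_metric)
  moreover have "\<forall>k. j (e k) \<in> closure (j ` range e)"
    by (intro allI subsetD[OF closure_subset]) auto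
  ultimately obtain l r where r: "strict_mono (r :: nat \<Rightarrow> nat)" "((\<lambda>k. j (e k)) \<circ> r) \<longlonglongrightarrow> l"
    by (rule seq_compactE)
  then have "Cauchy ((\<lambda>k. j (e k)) \<circ> r)" by (intro LIMSEQ_imp_Cauchy)
  \<comment> \<open>The tolerance anticipates the final scaling by \<open>R / norm d\<close>, a
    factor of at most \<open>R\<close> once \<open>norm d \<ge> 1\<close> is known.\<close>
  moreover have "0 < \<epsilon> / R" using \<open>0 < R\<close> \<open>0 < \<epsilon>\<close> by simp
  ultimately obtain M where
    M: "\<And>m n. m \<ge> M \<Longrightarrow> n \<ge> M \<Longrightarrow> dist (j (e (r m))) (j (e (r n))) < \<epsilon> / R"
    unfolding Cauchy_def o_def by metis
  define d where "d = e (r M) - e (r (Suc M))"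
  have ne: "r M \<noteq> r (Suc M)"
    using strict_mono_less[OF r(1), of M "Suc M"] by simp
  have "(norm d)\<^sup>2 = 2"
    using e(2) e(4)[OF ne] unfolding d_def power2_norm_eq_inner norm_eq_1
    by (simp add: inner_diff_left inner_diff_right inner_commute)
  then have d: "norm d \<ge> 1"
    by (intro power2_le_imp_le[of 1 "norm d"]) auto
  have jd: "norm (j d) < \<epsilon> / R"
    using M[of M "Suc M"] by (simp add: d_def j.diff dist_norm)
  have "d \<in> V" using e(1) V(1) by (auto simp: d_def intro: subspace_diff)
  show ?thesis
  proof (rule that[of "(R / norm d) *\<^sub>R d"])
    show "norm ((R / norm d) *\<^sub>R d) = R" using d \<open>0 < R\<close> by (cases "d = 0") auto
    have "norm (j ((R / norm d) *\<^sub>R d)) = R / norm d * norm (j d)"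
      using \<open>0 < R\<close> by (simp add: j.scaleR)
    also have "\<dots> \<le> R * norm (j d)"
      using d \<open>0 < R\<close> by (intro mult_right_mono) (auto simp: divide_le_eq mult_le_cancel_left1)
    also have "\<dots> < \<epsilon>" using jd \<open>0 < R\<close> by (simp add: field_simps)
    finally show "norm (j ((R / norm d) *\<^sub>R d)) < \<epsilon>" .
  qed (use \<open>d \<in> V\<close> V(1) e(3) in \<open>auto simp: d_def inner_diff_left intro: subspace_scale\<close>)
qed

section \<open>The orthogonal projector\<close>

text \<open>This is uniqueness: the difference of two candidates is orthogonal to \<open>S\<close>,
  hence to both candidates and so to itself.\<close>

lemma orth_proj_eqI:
  assumes "p \<in> S" "\<And>s. s \<in> S \<Longrightarrow> (x - p) \<bullet> s = 0"
  shows "orth_proj S x = p"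
  unfolding orth_proj_def
proof (rule the_equality)
  fix q assume q: "q \<in> S \<and> (\<forall>s\<in>S. (x - q) \<bullet> s = 0)"
  have "(q - p) \<bullet> s = 0" if "s \<in> S" for s
  proof -
    have "(q - p) \<bullet> s = (x - p) \<bullet> s - (x - q) \<bullet> s" by (simp add: inner_diff_left)
    then show ?thesis using q assms(2) that by simp
  qed
  then have "(q - p) \<bullet> (q - p) = 0" using q assms(1) by (simp add: inner_diff_right)
  then show "q = p" by simp
qed (use assms in auto)

text \<open>The spaces V and W are O-orthogonal by definition, and continuity of the scalar product
  extends this to the closure of V.\<close>

lemma P_proj_add:
  assumes "bounded_linear j" and v: "v \<in> V_space j a" and w: "w \<in> W_space a"
  shows "P_proj j a (j (w + v)) = j v"
  unfolding P_proj_def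
proof (rule orth_proj_eqI)
  interpret bounded_linear j by fact
  show "j v \<in> closure (j ` V_space j a)"
    using v by (intro subsetD[OF closure_subset] imageI)
  fix s assume s: "s \<in> closure (j ` V_space j a)"
  have "closed {s. j w \<bullet> s = 0}"
    by (intro closed_Collect_eq continuous_intros)
  moreover have "j ` V_space j a \<subseteq> {s. j w \<bullet> s = 0}"
    using w by (auto simp: V_space_def inner_commute)
  ultimately have "closure (j ` V_space j a) \<subseteq> {s. j w \<bullet> s = 0}"
    by (rule closure_minimal[rotated])
  then have "j w \<bullet> s = 0" using s by blast
  then show "(j (w + v) - j v) \<bullet> s = 0" by (simp add: add)
qed

section \<open>The spaces V and W and the gap\<close>

lemma subspace_W_space:
  assumes "bounded_bilinear a"
  shows "subspace (W_space a)"
proof -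
  interpret bounded_bilinear a by fact
  show ?thesis by (auto simp: subspace_def W_space_def add_left scaleR_left zero_left)
qed

lemma subspace_V_space:
  assumes "bounded_linear j"
  shows "subspace (V_space j a)"
proof -
  interpret bounded_linear j by fact
  show ?thesis by (auto simp: subspace_def V_space_def add scaleR zero inner_left_distrib)
qed

text \<open>These bounds hide both the case distinction and the boundedness required for the
  supremum; the first one also covers \<open>v = 0\<close>, where both sides vanish.\<close>

lemma V_gap_bounds:
  assumes "0 \<in> V_space j a"
  shows infdist_le_V_gap: "v \<in> V_sub j a Y \<Longrightarrow> infdist v (V_space j a) \<le> V_gap j a Y * norm v"
    and V_gap_nonneg: "0 \<le> V_gap j a Y"
proof -
  let ?q = "\<lambda>v. infdist v (V_space j a) / norm v"
  have "?q v \<le> 1" for v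
    using infdist_le[OF assms, of v] by (auto simp: divide_le_eq)
  then have bdd: "bdd_above (?q ` (V_sub j a Y - {0}))"
    by (intro bdd_aboveI[of _ 1]) auto
  have upper: "?q v \<le> V_gap j a Y" if "v \<in> V_sub j a Y" "v \<noteq> 0" for v
  proof -
    have "?q v \<le> (SUP v\<in>V_sub j a Y - {0}. ?q v)"
      using that by (intro cSUP_upper bdd) auto
    then show ?thesis using that by (auto simp: V_gap_def)
  qed
  show "infdist v (V_space j a) \<le> V_gap j a Y * norm v" if "v \<in> V_sub j a Y"
    using upper[OF that] assms by (cases "v = 0") (auto simp: divide_le_eq)
  show "0 \<le> V_gap j a Y"
  proof (cases "V_sub j a Y - {0} = {}")
    case False
    then obtain v where v: "v \<in> V_sub j a Y" "v \<noteq> 0" by blast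
    have "0 \<le> ?q v" by (simp add: infdist_nonneg)
    then show ?thesis using upper[OF v] by linarith
  qed (simp add: V_gap_def)
qed

text \<open>Translation by an element of the subspace leaves the distance to it unchanged, so a
  summand in V costs nothing, however large it is.\<close>

lemma infdist_add_le:
  fixes A :: "'x::real_normed_vector set"
  assumes "subspace A" "v \<in> A"
  shows "infdist (x + (w + v)) A \<le> infdist x A + norm w"
proof -
  have "A \<noteq> {}" using assms(2) by auto
  have "infdist (x + (w + v)) A - norm w \<le> dist x b" if "b \<in> A" for b
  proof -
    have "infdist (x + (w + v)) A \<le> dist (x + (w + v)) (b + v)"
      using assms that by (intro infdist_le subspace_add)
    also have "\<dots> = norm ((x - b) + w)" by (simp add: dist_norm algebra_simps)
    also have "\<dots> \<le> dist x b + norm w" unfolding dist_norm by (rule norm_triangle_ineq)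
    finally show ?thesis by simp
  qed
  then have "infdist (x + (w + v)) A - norm w \<le> (INF b\<in>A. dist x b)"
    using \<open>A \<noteq> {}\<close> by (intro cINF_greatest)
  then show ?thesis using \<open>A \<noteq> {}\<close> by (simp add: infdist_def)
qed

section \<open>The augmented spaces\<close>

theorem proposition22:
  fixes j :: "'x::{real_inner,complete_space} \<Rightarrow> 'o::{real_inner,complete_space}"
    and a :: "'x \<Rightarrow> 'x \<Rightarrow> real"
    and X :: "nat \<Rightarrow> 'x set"
  assumes O_infinite_dim: "\<not> finite_dim (UNIV :: 'o set)"
    and O_separable: "separable_space (euclidean :: 'o topology)"
    and inclusion: "bounded_linear j" "inj j"
    and dense: "closure (range j) = UNIV"
    and a_bilinear: "bounded_bilinear a"
    and a_symmetric: "\<And>u v. a u v = a v u"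
    and a_nonneg: "\<And>u. a u u \<ge> 0"
    and inner_X: "\<And>u v. u \<bullet> v = j u \<bullet> j v + a u v"
    and compact_inclusion:
      "\<And>B. B \<subseteq> V_space j a \<Longrightarrow> bounded B \<Longrightarrow> compact (closure (j ` B))"
    and W_infinite_dim: "\<not> finite_dim (W_space a)"
    and V_infinite_dim: "\<not> finite_dim (V_space j a)"
    and X_subspace: "\<And>n. subspace (X n)"
    and X_finite_dim: "\<And>n. finite_dim (X n)"
    and X_AS: "AS X"
    and X_VG: "VG j a X"
  shows "\<exists>u. (\<forall>n. u n \<notin> X n) \<and>
           (let X' = (\<lambda>n. {x + t *\<^sub>R u n | x t. x \<in> X n})
            in AS X' \<and> VG j a X' \<and> \<not> ODF j a X')"
proof -
  interpret j: bounded_linear j by (fact inclusion(1))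
  let ?V = "V_space j a" and ?W = "W_space a"
  have subV: "subspace ?V" and subW: "subspace ?W"
    using subspace_V_space[OF inclusion(1)] subspace_W_space[OF a_bilinear] by auto
  \<comment> \<open>Since \<open>a\<close> vanishes on W, the scalar products of X and O agree as
    soon as one argument lies in W. Hence V and W are orthogonal in X too.\<close>
  have W_inner: "x \<bullet> w = j x \<bullet> j w" if "w \<in> ?W" for x w
    using that inner_X[of x w] a_symmetric[of x w] by (simp add: W_space_def)
  have VW: "v \<bullet> w = 0" if "v \<in> ?V" "w \<in> ?W" for v w
    using that W_inner by (simp add: V_space_def)

  have "\<exists>w v. w \<in> ?W \<and> norm w = 1 \<and> (\<forall>x\<in>X n. w \<bullet> x = 0) \<and> v \<in> ?V \<and> norm v = real (Suc n)
      \<and> norm (j v) < inverse (real (Suc n)) \<and> (\<forall>x\<in>X n. v \<bullet> x = 0)" for n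
  proof -
    obtain S where S: "finite S" "span S = X n"
      using X_finite_dim[of n] by (auto simp: finite_dim_def)
    obtain w where "w \<in> ?W" "norm w = 1" "\<And>x. x \<in> span S \<Longrightarrow> w \<bullet> x = 0"
      using obtain_unit_orthogonal[OF S(1) subW W_infinite_dim] by metis
    moreover obtain v where "v \<in> ?V" "norm v = real (Suc n)"
        "norm (j v) < inverse (real (Suc n))" "\<And>x. x \<in> span S \<Longrightarrow> v \<bullet> x = 0"
      using obtain_large_with_small_image[OF inclusion(1) S(1) subV V_infinite_dim compact_inclusion,
          of "real (Suc n)" "inverse (real (Suc n))"]
      by (metis inverse_positive_iff_positive of_nat_0_less_iff zero_less_Suc)
    ultimately show ?thesis using S(2) by blast
  qed
  then obtain w v where w: "\<And>n. w n \<in> ?W" "\<And>n. norm (w n) = 1" "\<And>n x. x \<in> X n \<Longrightarrow> w n \<bullet> x = 0"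
    and v: "\<And>n. v n \<in> ?V" "\<And>n. norm (v n) = real (Suc n)"
      "\<And>n. norm (j (v n)) < inverse (real (Suc n))" "\<And>n x. x \<in> X n \<Longrightarrow> v n \<bullet> x = 0"
    by metis
  define u where "u = (\<lambda>n. w n + v n)"
  define X' where "X' = (\<lambda>n. {x + t *\<^sub>R u n | x t. x \<in> X n})"

  have u_orth: "u n \<bullet> x = 0" if "x \<in> X n" for n x
    using w(3) v(4) that by (simp add: u_def inner_left_distrib)
  have vu: "v n \<bullet> u n = (norm (v n))\<^sup>2" for n
    using VW[OF v(1) w(1), of n n] by (simp add: u_def inner_right_distrib power2_norm_eq_inner)
  \<comment> \<open>Testing \<open>u n\<close> against \<open>v n\<close> removes the component
    \<open>w n\<close>, so Cauchy-Schwarz bounds \<open>norm (u n)\<close> below by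
    \<open>norm (v n)\<close>.\<close>
  have norm_u: "real (Suc n) \<le> norm (u n)" for n
  proof -
    have "norm (v n) * norm (v n) \<le> norm (v n) * norm (u n)"
      using norm_cauchy_schwarz[of "v n" "u n"] by (simp add: vu power2_eq_square)
    then show ?thesis using v(2)[of n] by simp
  qed
  have u_notin: "u n \<notin> X n" for n
    using u_orth[of "u n" n] norm_u[of n] by auto
  have X_sub: "X n \<subseteq> X' n" for n
  proof
    fix x assume "x \<in> X n"
    then show "x \<in> X' n" unfolding X'_def by (force intro: exI[of _ "0::real"])
  qed

  \<comment> \<open>The discrete W-space does not grow: pairing with \<open>v n\<close> kills W and
    \<open>X n\<close>, and so isolates the coefficient of \<open>u n\<close>, which must be
    0.\<close>
  have W_sub_X': "W_sub a (X' n) = W_sub a (X n)" for n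
  proof
    show "W_sub a (X n) \<subseteq> W_sub a (X' n)" using X_sub by (auto simp: W_sub_def)
    show "W_sub a (X' n) \<subseteq> W_sub a (X n)"
    proof
      fix y assume y: "y \<in> W_sub a (X' n)"
      then obtain x t where x: "x \<in> X n" "y = x + t *\<^sub>R u n"
        by (auto simp: W_sub_def X'_def)
      have "t * (norm (v n))\<^sup>2 = v n \<bullet> y"
        using v(4)[OF x(1)] by (simp add: x(2) inner_right_distrib vu)
      also have "\<dots> = 0" using y VW[OF v(1)] by (simp add: W_sub_def)
      finally have "t = 0" using v(2)[of n] by simp
      then show "y \<in> W_sub a (X n)" using x y by (simp add: W_sub_def)
    qed
  qed
  have u_W: "j (u n) \<bullet> j y = 0" if "y \<in> W_sub a (X n)" for n y
    using that u_orth[of y n] W_inner[of y "u n"] by (simp add: W_sub_def)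
  have u_in: "u n \<in> V_sub j a (X' n)" for n
  proof -
    have "u n = 0 + 1 *\<^sub>R u n" by simp
    then have "u n \<in> X' n" unfolding X'_def using subspace_0[OF X_subspace] by blast
    then show ?thesis using u_W by (simp add: V_sub_def W_sub_X')
  qed

  have gap: "V_gap j a (X' n) \<le> V_gap j a (X n) + inverse (real (Suc n))" for n
  proof -
    have "infdist y ?V / norm y \<le> V_gap j a (X n) + inverse (real (Suc n))"
      if y: "y \<in> V_sub j a (X' n) - {0}" for y
    proof -
      from y obtain x t where x: "x \<in> X n" "y = x + t *\<^sub>R u n"
        by (auto simp: V_sub_def X'_def)
      \<comment> \<open>Both \<open>y\<close> and \<open>u n\<close> are O-orthogonal to the common
        discrete W-space, hence so is \<open>x\<close>: the new discrete V-space splits as the old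
        one plus the line through \<open>u n\<close>.\<close>
      have "j x \<bullet> j z = 0" if "z \<in> W_sub a (X n)" for z
      proof -
        have "j y \<bullet> j z = 0" using y that by (simp add: V_sub_def W_sub_X')
        then show ?thesis
          using u_W[OF that] by (simp add: x(2) j.add j.scaleR inner_left_distrib)
      qed
      then have x_V: "x \<in> V_sub j a (X n)" using x(1) by (simp add: V_sub_def)
      have pyth: "(norm y)\<^sup>2 = (norm x)\<^sup>2 + (norm (t *\<^sub>R u n))\<^sup>2"
        using u_orth[OF x(1)] unfolding x(2)
        by (intro norm_add_Pythagorean) (simp add: orthogonal_def inner_commute)
      have xy: "norm x \<le> norm y" and "norm (t *\<^sub>R u n) \<le> norm y"
        by (rule power2_le_imp_le; simp add: pyth)+
      \<comment> \<open>The largeness of \<open>u n\<close> in X forces its coefficient to be small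
        relative to \<open>norm y\<close>.\<close>
      have "\<bar>t\<bar> * real (Suc n) \<le> \<bar>t\<bar> * norm (u n)"
        using norm_u by (intro mult_left_mono) auto
      also have "\<dots> \<le> norm y" using \<open>norm (t *\<^sub>R u n) \<le> norm y\<close> by simp
      finally have t: "\<bar>t\<bar> \<le> inverse (real (Suc n)) * norm y"
        by (simp add: field_simps)
      \<comment> \<open>The part \<open>t *\<^sub>R v n\<close> lies in V, so only
        \<open>t *\<^sub>R w n\<close>, of norm \<open>\<bar>t\<bar>\<close>, adds to the
        distance.\<close>
      have "infdist y ?V \<le> infdist x ?V + norm (t *\<^sub>R w n)"
        using infdist_add_le[OF subV subspace_scale[OF subV v(1)], of x "t *\<^sub>R w n" t n]
        by (simp add: x(2) u_def scaleR_add_right)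
      also have "\<dots> = infdist x ?V + \<bar>t\<bar>" by (simp add: w(2))
      also have "\<dots> \<le> V_gap j a (X n) * norm x + inverse (real (Suc n)) * norm y"
        using infdist_le_V_gap[OF subspace_0[OF subV] x_V] t by linarith
      also have "\<dots> \<le> (V_gap j a (X n) + inverse (real (Suc n))) * norm y"
        using mult_left_mono[OF xy V_gap_nonneg[OF subspace_0[OF subV]]] by (simp add: distrib_right)
      finally show ?thesis using y by (simp add: divide_le_eq)
    qed
    \<comment> \<open>The vector \<open>u n\<close> is a nonzero member, so \<open>V_gap\<close> is
      here the actual supremum.\<close>
    moreover have "V_sub j a (X' n) - {0} \<noteq> {}"
      using u_in[of n] norm_u[of n] by auto
    ultimately show ?thesis
      unfolding V_gap_def[of j a "X' n"] by (auto intro!: cSUP_least)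
  qed

  have "AS X'"
    unfolding AS_def
  proof
    fix x
    have "infdist x (X' n) \<le> infdist x (X n)" for n
      using X_sub subspace_0[OF X_subspace] by (intro infdist_mono) auto
    then show "(\<lambda>n. infdist x (X' n)) \<longlonglongrightarrow> 0"
      by (intro tendsto_sandwich[OF _ _ tendsto_const X_AS[unfolded AS_def, rule_format, of x]])
        (auto simp: infdist_nonneg)
  qed
  moreover have "VG j a X'"
    unfolding VG_def
  proof (rule tendsto_sandwich[where f = "\<lambda>_. 0"])
    show "(\<lambda>n. V_gap j a (X n) + inverse (real (Suc n))) \<longlonglongrightarrow> 0"
      using tendsto_add[OF X_VG[unfolded VG_def] LIMSEQ_inverse_real_of_nat] by simp
  qed (use gap V_gap_nonneg[OF subspace_0[OF subV]] in auto)
  moreover have "\<not> ODF j a X'"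
  proof
    assume "ODF j a X'"
    then obtain C where C: "C > 0"
      "\<And>n y. y \<in> V_sub j a (X' n) \<Longrightarrow> norm (j y) \<le> C * norm (P_proj j a (j y))"
      by (auto simp: ODF_def)
    obtain n where n: "inverse (real (Suc n)) < inverse C"
      using reals_Archimedean[of "inverse C"] C(1) by auto
    \<comment> \<open>On W the two norms agree, so \<open>j (w n)\<close> is a unit vector; pairing
      it with \<open>j (u n)\<close> keeps the O-norm of \<open>u n\<close> at least 1.\<close>
    have jw: "j (u n) \<bullet> j (w n) = 1" "norm (j (w n)) = 1"
      using W_inner[OF w(1)[of n], of "u n"] W_inner[OF w(1)[of n], of "w n"]
        VW[OF v(1) w(1), of n n] w(2)[of n]
      by (auto simp: u_def inner_left_distrib norm_eq_1)
    have "1 \<le> norm (j (u n))"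
      using norm_cauchy_schwarz[of "j (u n)" "j (w n)"] jw by simp
    \<comment> \<open>The projector maps \<open>j (u n)\<close> to \<open>j (v n)\<close>, whose
      norm is below \<open>inverse C\<close> by the choice of \<open>n\<close>; the chain ends in 1
      < 1.\<close>
    also have "\<dots> \<le> C * norm (j (v n))"
      using C(2)[OF u_in[of n]] P_proj_add[OF inclusion(1) v(1) w(1), of n n] by (simp add: u_def)
    also have "\<dots> < C * inverse C"
      using less_trans[OF v(3) n] C(1) by (rule mult_strict_left_mono)
    finally show False using C(1) by simp
  qed
  ultimately show ?thesis
    using u_notin unfolding X'_def Let_def by blast
qed

end
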